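(* Let $b\ge 2$ be an integer. (1) For all integers $n\ge 1$ and $m\ge 1$, $\gcd\bigl(M_n^{(b)},M_m^{(b)}\bigr)=M_{\gcd(n,m)}^{(b)}$. (2) For all odd integers $n\ge 1$ and $m\ge 1$, $\gcd\bigl(M_n^{+(b)},M_m^{+(b)}\bigr)=M_{\gcd(n,m)}^{+(b)}$.
   Context: The generalized repunit numbers are the integers $M_n^{(b)}=(b^n-1)/(b-1)$, defined for integers $n\ge 1$, $b\ge 2$, and $M_n^{+(b)}=(b^n+1)/(b+1)$, defined for odd integers $n\ge 1$ and integers $b\ge 2$. *)

theory Defs
  imports Complex_Main
begin

text \<open>
  Both quotients below are taken with integer division. It is exact in the intended range of
  the parameters: \<open>repunit_mult\<close> and \<open>repunit_plus_mult\<close> below say so, and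
  \<open>of_int_repunit\<close> and \<open>of_int_repunit_plus\<close> identify the
  values with the quotients of rational numbers.
\<close>

definition repunit :: "int \<Rightarrow> nat \<Rightarrow> int" where
  "repunit b n = (b ^ n - 1) div (b - 1)"

text \<open>Only meaningful for odd \<open>n\<close>; for even \<open>n\<close> the division need not be exact.\<close>

definition repunit_plus :: "int \<Rightarrow> nat \<Rightarrow> int" where
  "repunit_plus b n = (b ^ n + 1) div (b + 1)"

lemma repunit_mult: "(b - 1) * repunit b n = b ^ n - 1"
proof -
  have "b - 1 dvd b ^ n - 1"
    by (simp add: power_diff_1_eq)
  then show ?thesis
    by (simp add: repunit_def)
qed

lemma repunit_plus_mult:
  assumes "odd n"
  shows "(b + 1) * repunit_plus b n = b ^ n + 1"
proof -
  have "(- b) - 1 dvd (- b) ^ n - 1"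
    by (simp only: power_diff_1_eq dvd_triv_left)
  moreover have "(- b) - 1 = - (b + 1)" "(- b) ^ n - 1 = - (b ^ n + 1)"
    using assms by simp_all
  ultimately have "- (b + 1) dvd - (b ^ n + 1)"
    by (simp only:)
  then have "b + 1 dvd b ^ n + 1"
    by (simp only: minus_dvd_iff dvd_minus_iff)
  then show ?thesis
    by (simp add: repunit_plus_def)
qed

lemma of_int_repunit:
  assumes "b \<ge> 2"
  shows "rat_of_int (repunit b n) = (rat_of_int b ^ n - 1) / (rat_of_int b - 1)"
proof -
  have "(rat_of_int b - 1) * rat_of_int (repunit b n) = rat_of_int b ^ n - 1"
    using arg_cong[OF repunit_mult[of b n], of rat_of_int] by simp
  then show ?thesis
    using assms by (simp add: nonzero_eq_divide_eq mult.commute)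
qed

lemma of_int_repunit_plus:
  assumes "b \<ge> 2" and "odd n"
  shows "rat_of_int (repunit_plus b n) = (rat_of_int b ^ n + 1) / (rat_of_int b + 1)"
proof -
  have "(rat_of_int b + 1) * rat_of_int (repunit_plus b n) = rat_of_int b ^ n + 1"
    using arg_cong[OF repunit_plus_mult[OF assms(2), of b], of rat_of_int] by simp
  moreover have "rat_of_int b + 1 \<noteq> 0"
    using assms(1) by linarith
  ultimately show ?thesis
    by (simp add: nonzero_eq_divide_eq mult.commute)
qed

end

theory Submission
  imports Defs
begin

text \<open>
  Euclid's algorithm on the exponents gives \<open>gcd (b\<^sup>n - 1) (b\<^sup>m - 1) = \<bar>b\<^bsup>gcd n m\<^esup> - 1\<bar>\<close> for every
  integer \<open>b\<close>. Cancelling \<open>b - 1\<close> yields part (1), up to a sign, for every \<open>b \<noteq> 1\<close>. As \<open>b\<close> may be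
  negative, part (2) is the same statement for \<open>- b\<close>.
\<close>

lemma gcd_power_diff_1:
  fixes b :: int
  shows "gcd (b ^ n - 1) (b ^ m - 1) = \<bar>b ^ gcd n m - 1\<bar>"
proof (induction n m rule: gcd_nat_induct)
  case (base n)
  then show ?case by simp
next
  case (step n m)
  \<comment> \<open>Modulo \<open>b ^ m - 1\<close> the power \<open>b ^ m\<close> is 1, so
    \<open>b ^ n\<close> reduces to \<open>b ^ (n mod m)\<close>.\<close>
  have "(b ^ m) - 1 dvd (b ^ m) ^ (n div m) - 1"
    by (simp only: power_diff_1_eq dvd_triv_left)
  then obtain k where k: "(b ^ m) ^ (n div m) - 1 = (b ^ m - 1) * k" ..
  have "b ^ n = b ^ (m * (n div m) + n mod m)" by simp
  also have "\<dots> = (b ^ m) ^ (n div m) * b ^ (n mod m)"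
    by (simp only: power_add power_mult)
  finally have "b ^ n - 1 = ((b ^ m) ^ (n div m) - 1) * b ^ (n mod m) + (b ^ (n mod m) - 1)"
    by (simp add: algebra_simps)
  then have "b ^ n - 1 = (k * b ^ (n mod m)) * (b ^ m - 1) + (b ^ (n mod m) - 1)"
    unfolding k by (simp add: ac_simps)
  then have "gcd (b ^ n - 1) (b ^ m - 1) = gcd (b ^ m - 1) (b ^ (n mod m) - 1)"
    by (simp only: gcd_add_mult gcd.commute[of _ "b ^ m - 1"])
  then show ?case
    using step.IH by (simp add: gcd_red_nat[of n m])
qed

lemma gcd_repunit:
  assumes "b \<noteq> 1"
  shows "gcd (repunit b n) (repunit b m) = \<bar>repunit b (gcd n m)\<bar>"
proof -
  \<comment> \<open>A factor leaves a gcd only in absolute value, and \<open>b - 1\<close> may be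
    negative.\<close>
  have "\<bar>b - 1\<bar> * gcd (repunit b n) (repunit b m) = \<bar>b - 1\<bar> * \<bar>repunit b (gcd n m)\<bar>"
    using gcd_power_diff_1[of b n m]
    by (simp flip: repunit_mult abs_mult add: gcd_mult_distrib_int)
  then show ?thesis
    using assms by simp
qed

lemma repunit_nonneg: "b \<ge> 1 \<Longrightarrow> repunit b n \<ge> 0"
  \<comment> \<open>At \<open>b = 1\<close> the quotient is \<open>0 div 0\<close>, which is
    0.\<close>
  by (cases "b = 1") (simp_all add: repunit_def pos_imp_zdiv_nonneg_iff)

lemma repunit_plus_nonneg: "b \<ge> 0 \<Longrightarrow> repunit_plus b n \<ge> 0"
  by (simp add: repunit_plus_def pos_imp_zdiv_nonneg_iff)

text \<open>An odd power keeps the sign, so numerator and denominator both change sign and the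
  quotient stays the same.\<close>

lemma repunit_uminus:
  assumes "odd n"
  shows "repunit (- b) n = repunit_plus b n"
proof -
  have "(- b) ^ n - 1 = - (b ^ n + 1)" "- b - 1 = - (b + 1)"
    using assms by simp_all
  then show ?thesis
    by (simp only: repunit_def repunit_plus_def div_minus_minus)
qed

theorem theorem6:
  fixes b :: int
  assumes "b \<ge> 2"
  shows "(\<forall>n m :: nat. n \<ge> 1 \<longrightarrow> m \<ge> 1 \<longrightarrow>
            gcd (repunit b n) (repunit b m) = repunit b (gcd n m)) \<and>
         (\<forall>n m :: nat. n \<ge> 1 \<longrightarrow> m \<ge> 1 \<longrightarrow> odd n \<longrightarrow> odd m \<longrightarrow>
            gcd (repunit_plus b n) (repunit_plus b m) = repunit_plus b (gcd n m))"
proof (intro conjI allI impI)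
  fix n m :: nat
  show "gcd (repunit b n) (repunit b m) = repunit b (gcd n m)"
    using assms by (simp add: gcd_repunit repunit_nonneg)
next
  fix n m :: nat
  assume "odd n" "odd m"
  \<comment> \<open>This lets \<open>repunit_uminus\<close> rewrite the right-hand side too;
    nonnegativity then removes the absolute value.\<close>
  then have "odd (gcd n m)" by simp
  with \<open>odd n\<close> \<open>odd m\<close> show "gcd (repunit_plus b n) (repunit_plus b m) = repunit_plus b (gcd n m)"
    using assms gcd_repunit[of "- b" n m] by (simp add: repunit_uminus repunit_plus_nonneg)
qed

end
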